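(* For $n\ge2$ and $1\le k\le n$, put $r=n-k$ and $$\lambda:=\frac43\binom r2\frac{n-\frac12}{n(n-1)},\quad f_1:=\binom r2(2r-3)\Big(\frac{4}{3n}\cdot\frac{n-\frac12}{n-1}\Big)^2,\quad f_2:=\frac{\binom r2(2r-3)}{\binom n2},$$ $$c_1^A:=r(r-1)\Big(r-\tfrac32\Big)\frac{64}{9n^2}\cdot\frac{(n-\frac12)^2}{(n-1)^2},\qquad c_2^A:=r(r-1)(r-2)\frac{40}{3n^2}\cdot\frac{n(n-\frac{17}{5})+\frac{17}{5}}{(n-1)^2}.$$ Then $$\frac{\binom n2^{r}}{r!}e^{-\lambda}\big(1-e^{\lambda}(f_1+f_2)\big)\le s(n,k)\le\frac{\binom n2^{r}}{r!}e^{-\lambda}\big(1+e^{\lambda}(f_1+f_2)\big),$$ $$\frac{\binom n2^{r}}{r!}e^{-2\lambda}\big(1-e^{2\lambda}(c_1^A+c_2^A)\big)\le S(n,k)\le\frac{\binom n2^{r}}{r!}e^{-2\lambda}\big(1+e^{2\lambda}(c_1^A+c_2^A)\big).$$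
   Context: $s(n,k)$ is the unsigned Stirling number of the first kind (number of permutations of $\{1,\dots,n\}$ with exactly $k$ cycles), and $S(n,k)$ is the Stirling number of the second kind (number of partitions of $\{1,\dots,n\}$ into exactly $k$ nonempty blocks). *)

theory Defs
  imports Complex_Main "HOL-Combinatorics.Stirling"
begin

end

theory Submission
  imports Defs "HOL-Combinatorics.Multiset_Permutations"
begin

text \<open>
  The numbers \<open>s(n, n - r)\<close> and \<open>S(n, n - r)\<close> count the sets of \<open>r\<close> cells \<open>(i, j)\<close> of the staircase
  \<open>i < j < n\<close> with pairwise distinct columns, respectively with pairwise distinct columns and pairwise
  distinct rows. Hence, after division by \<open>B\<close>, each is the probability that \<open>r\<close> independent uniform
  cells have no collision. Let \<open>W\<close> be the number of collisions, a sum of indicators \<open>X\<^sub>\<alpha>\<close> that are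
  independent of the indicators on disjoint pairs of positions; its mean \<open>\<mu>\<close> is \<open>\<lambda>\<close>, respectively
  \<open>2\<lambda>\<close>. The function \<open>h(t) = E[t\<^sup>W] e\<^bsup>-\<mu>t\<^esup>\<close> satisfies \<open>h(0) = P(W = 0)\<close> and \<open>h(1) = e\<^bsup>-\<mu>\<^esup>\<close>, and
  dropping the neighbours of \<open>\<alpha>\<close> from \<open>W\<close> in each term of \<open>h'\<close> shows \<open>-b\<^sub>2 \<le> h' \<le> b\<^sub>1\<close>, where \<open>b\<^sub>1\<close>
  and \<open>b\<^sub>2\<close> are the Chen--Stein quantities. Every joint collision probability in \<open>b\<^sub>2\<close> is at most
  \<open>1 / (n choose 2)\<close>, because the column lengths \<open>j\<close> satisfy \<open>\<Sum> j\<^sup>3 = (n choose 2)\<^sup>2\<close>.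
\<close>

section \<open>Stein's method for the probability of zero\<close>

text \<open>Expectation under the uniform distribution, kept as a finite sum. For an empty or
  infinite \<open>A\<close> it is 0, which frees the linearity rules below from side
  conditions.\<close>

definition mean :: "'a set \<Rightarrow> ('a \<Rightarrow> real) \<Rightarrow> real" where
  "mean A f = (\<Sum>x\<in>A. f x) / real (card A)"

lemma mean_cong: "(\<And>x. x \<in> A \<Longrightarrow> f x = g x) \<Longrightarrow> mean A f = mean A g"
  by (simp add: mean_def)

lemma mean_mono: "(\<And>x. x \<in> A \<Longrightarrow> f x \<le> g x) \<Longrightarrow> mean A f \<le> mean A g"
  unfolding mean_def by (intro divide_right_mono sum_mono) auto

lemma mean_nonneg: "(\<And>x. x \<in> A \<Longrightarrow> 0 \<le> f x) \<Longrightarrow> 0 \<le> mean A f"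
  unfolding mean_def by (intro divide_nonneg_nonneg sum_nonneg) auto

lemma mean_add: "mean A (\<lambda>x. f x + g x) = mean A f + mean A g"
  by (simp add: mean_def sum.distrib add_divide_distrib)

lemma mean_diff: "mean A (\<lambda>x. f x - g x) = mean A f - mean A g"
  by (simp add: mean_def sum_subtractf diff_divide_distrib)

lemma mean_cmult: "mean A (\<lambda>x. c * f x) = c * mean A f"
  by (simp add: mean_def sum_distrib_left)

lemma mean_multc: "mean A (\<lambda>x. f x * c) = mean A f * c"
  by (simp add: mean_def sum_distrib_right)

lemma mean_const: "finite A \<Longrightarrow> A \<noteq> {} \<Longrightarrow> mean A (\<lambda>_. c) = c"
  by (simp add: mean_def)

lemma mean_sum: "mean A (\<lambda>x. \<Sum>i\<in>I. f i x) = (\<Sum>i\<in>I. mean A (f i))"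
  unfolding mean_def by (subst sum.swap) (simp add: sum_divide_distrib)

lemma mean_of_bool: "finite A \<Longrightarrow> mean A (\<lambda>x. of_bool (P x)) = real (card {x\<in>A. P x}) / real (card A)"
  by (simp add: mean_def of_bool_def sum.If_cases Int_def)

lemma real_card_filter: "finite A \<Longrightarrow> real (card {x\<in>A. P x}) = (\<Sum>x\<in>A. of_bool (P x))"
  by (simp add: of_bool_def sum.If_cases Int_def)

text \<open>For \<open>z = 0\<close> both sides agree, and for \<open>z > 0\<close> the left side is
  at most 0. This gives the price, in expectation, of putting \<open>z\<close> neighbouring events
  back into the exponent.\<close>

lemma power_add_ge_minus:
  fixes t :: real
  assumes "0 \<le> t" "t \<le> 1"
  shows "t ^ v - real z \<le> t ^ (v + z)"
proof (cases z)
  case (Suc m)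
  have "t ^ v \<le> 1" "0 \<le> t ^ (v + z)" using assms by (auto simp: power_le_one)
  with Suc show ?thesis by simp
qed simp

text \<open>\<open>D\<close> is h(1) - h(0), so it equals h' at some point of (0, 1) by the mean
  value theorem. The factor of h' besides the exponential is a sum over \<open>J\<close>, bounded
  term by term. Independence is needed only between \<open>X \<alpha>\<close> and the generating
  function of the number of events outside \<open>N \<alpha>\<close>.\<close>

lemma stein_poisson_zero:
  fixes X :: "'j \<Rightarrow> 'w \<Rightarrow> bool" and p :: "'j \<Rightarrow> real"
  assumes \<Omega>: "finite \<Omega>" "\<Omega> \<noteq> {}" and J: "finite J"
    and nbhd: "\<And>\<alpha>. \<alpha> \<in> J \<Longrightarrow> \<alpha> \<in> N \<alpha>" "\<And>\<alpha>. \<alpha> \<in> J \<Longrightarrow> N \<alpha> \<subseteq> J"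
    and indep: "\<And>\<alpha> t. \<alpha> \<in> J \<Longrightarrow>
      mean \<Omega> (\<lambda>\<omega>. of_bool (X \<alpha> \<omega>) * t ^ card {\<beta>\<in>J - N \<alpha>. X \<beta> \<omega>})
        = p \<alpha> * mean \<Omega> (\<lambda>\<omega>. t ^ card {\<beta>\<in>J - N \<alpha>. X \<beta> \<omega>})"
  defines "D \<equiv> exp (- (\<Sum>\<alpha>\<in>J. p \<alpha>)) - mean \<Omega> (\<lambda>\<omega>. of_bool (\<forall>\<alpha>\<in>J. \<not> X \<alpha> \<omega>))"
  shows "D \<le> (\<Sum>\<alpha>\<in>J. \<Sum>\<beta>\<in>N \<alpha>. p \<alpha> * p \<beta>)"
    and "- D \<le> (\<Sum>\<alpha>\<in>J. \<Sum>\<beta>\<in>N \<alpha> - {\<alpha>}. mean \<Omega> (\<lambda>\<omega>. of_bool (X \<alpha> \<omega>) * of_bool (X \<beta> \<omega>)))"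
proof -
  define lam where "lam = (\<Sum>\<alpha>\<in>J. p \<alpha>)"
  define W where "W \<omega> = card {\<beta>\<in>J. X \<beta> \<omega>}" for \<omega>
  define V where "V \<alpha> \<omega> = card {\<beta>\<in>J - N \<alpha>. X \<beta> \<omega>}" for \<alpha> \<omega>
  define b1 where "b1 = (\<Sum>\<alpha>\<in>J. \<Sum>\<beta>\<in>N \<alpha>. p \<alpha> * p \<beta>)"
  define b2 where "b2 = (\<Sum>\<alpha>\<in>J. \<Sum>\<beta>\<in>N \<alpha> - {\<alpha>}. mean \<Omega> (\<lambda>\<omega>. of_bool (X \<alpha> \<omega>) * of_bool (X \<beta> \<omega>)))"
  define G where "G t = mean \<Omega> (\<lambda>\<omega>. t ^ W \<omega>)" for t
  define G' where "G' t = mean \<Omega> (\<lambda>\<omega>. real (W \<omega>) * t ^ (W \<omega> - 1))" for t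
  \<comment> \<open>At \<open>t = 1\<close> the independence hypothesis says that
    \<open>p \<alpha>\<close> is the probability of \<open>X \<alpha>\<close>.\<close>
  have p_eq: "p \<alpha> = mean \<Omega> (\<lambda>\<omega>. of_bool (X \<alpha> \<omega>))" if "\<alpha> \<in> J" for \<alpha>
    using indep[OF that, of 1] \<Omega> by (simp add: mean_const)
  have p_nonneg: "0 \<le> p \<alpha>" if "\<alpha> \<in> J" for \<alpha>
    using p_eq[OF that] by (simp add: mean_nonneg)
  have finN: "finite (N \<alpha>)" if "\<alpha> \<in> J" for \<alpha> using nbhd(2)[OF that] J finite_subset by blast
  have lam_nonneg: "0 \<le> lam" unfolding lam_def by (intro sum_nonneg p_nonneg)
  have b1_nonneg: "0 \<le> b1" unfolding b1_def
    by (intro sum_nonneg mult_nonneg_nonneg p_nonneg) (use nbhd in auto)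
  have b2_nonneg: "0 \<le> b2" unfolding b2_def by (intro sum_nonneg mean_nonneg) auto
  have W_split: "W \<omega> = V \<alpha> \<omega> + card {\<beta>\<in>N \<alpha>. X \<beta> \<omega>}" if "\<alpha> \<in> J" for \<alpha> \<omega>
  proof -
    have "{\<beta>\<in>J. X \<beta> \<omega>} = {\<beta>\<in>J - N \<alpha>. X \<beta> \<omega>} \<union> {\<beta>\<in>N \<alpha>. X \<beta> \<omega>}" using nbhd(2)[OF that] by auto
    then show ?thesis unfolding W_def V_def using J finN[OF that]
      by (simp add: card_Un_disjoint disjoint_iff)
  qed
  \<comment> \<open>The event \<open>X \<alpha>\<close> itself accounts for the 1 that
    differentiation removes from the exponent.\<close>
  have W_pred: "W \<omega> - 1 = V \<alpha> \<omega> + card {\<beta>\<in>N \<alpha> - {\<alpha>}. X \<beta> \<omega>}" if "\<alpha> \<in> J" "X \<alpha> \<omega>" for \<alpha> \<omega>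
  proof -
    have "{\<beta>\<in>N \<alpha>. X \<beta> \<omega>} = insert \<alpha> {\<beta>\<in>N \<alpha> - {\<alpha>}. X \<beta> \<omega>}" using that nbhd(1)[OF that(1)] by auto
    then have "card {\<beta>\<in>N \<alpha>. X \<beta> \<omega>} = Suc (card {\<beta>\<in>N \<alpha> - {\<alpha>}. X \<beta> \<omega>})"
      using finN[OF that(1)] by simp
    then show ?thesis using W_split[OF that(1), of \<omega>] by simp
  qed
  have G'_eq: "G' t = (\<Sum>\<alpha>\<in>J. mean \<Omega> (\<lambda>\<omega>. of_bool (X \<alpha> \<omega>) * t ^ (W \<omega> - 1)))" for t
    unfolding G'_def mean_sum[symmetric] W_def real_card_filter[OF J] sum_distrib_right ..
  have term_bounds:
    "mean \<Omega> (\<lambda>\<omega>. of_bool (X \<alpha> \<omega>) * t ^ (W \<omega> - 1)) - p \<alpha> * G t \<le> (\<Sum>\<beta>\<in>N \<alpha>. p \<alpha> * p \<beta>)"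
    "- (\<Sum>\<beta>\<in>N \<alpha> - {\<alpha>}. mean \<Omega> (\<lambda>\<omega>. of_bool (X \<alpha> \<omega>) * of_bool (X \<beta> \<omega>)))
       \<le> mean \<Omega> (\<lambda>\<omega>. of_bool (X \<alpha> \<omega>) * t ^ (W \<omega> - 1)) - p \<alpha> * G t"
    if \<alpha>: "\<alpha> \<in> J" and t: "0 < t" "t < 1" for \<alpha> t
  proof -
    have ind: "mean \<Omega> (\<lambda>\<omega>. of_bool (X \<alpha> \<omega>) * t ^ V \<alpha> \<omega>) = p \<alpha> * mean \<Omega> (\<lambda>\<omega>. t ^ V \<alpha> \<omega>)"
      unfolding V_def using indep[OF \<alpha>] .
    \<comment> \<open>Dropping the neighbours from the exponent can only increase a power of
      \<open>t < 1\<close>; restoring them in \<open>G t\<close> costs at most their expected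
      number.\<close>
    have "mean \<Omega> (\<lambda>\<omega>. of_bool (X \<alpha> \<omega>) * t ^ (W \<omega> - 1)) \<le> mean \<Omega> (\<lambda>\<omega>. of_bool (X \<alpha> \<omega>) * t ^ V \<alpha> \<omega>)"
      using t W_pred[OF \<alpha>] by (intro mean_mono) (auto simp: of_bool_def intro!: power_decreasing)
    moreover have "mean \<Omega> (\<lambda>\<omega>. t ^ V \<alpha> \<omega>) - (\<Sum>\<beta>\<in>N \<alpha>. p \<beta>) \<le> G t"
    proof -
      have "(\<Sum>\<beta>\<in>N \<alpha>. p \<beta>) = mean \<Omega> (\<lambda>\<omega>. real (card {\<beta>\<in>N \<alpha>. X \<beta> \<omega>}))"
        unfolding real_card_filter[OF finN[OF \<alpha>]] mean_sum
        using nbhd(2)[OF \<alpha>] p_eq by (intro sum.cong) auto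
      then show ?thesis unfolding G_def
        using t by (simp add: mean_diff[symmetric] W_split[OF \<alpha>] power_add_ge_minus mean_mono)
    qed
    then have "p \<alpha> * (mean \<Omega> (\<lambda>\<omega>. t ^ V \<alpha> \<omega>) - (\<Sum>\<beta>\<in>N \<alpha>. p \<beta>)) \<le> p \<alpha> * G t"
      using p_nonneg[OF \<alpha>] by (rule mult_left_mono)
    ultimately show "mean \<Omega> (\<lambda>\<omega>. of_bool (X \<alpha> \<omega>) * t ^ (W \<omega> - 1)) - p \<alpha> * G t \<le> (\<Sum>\<beta>\<in>N \<alpha>. p \<alpha> * p \<beta>)"
      unfolding sum_distrib_left[symmetric] using ind by (simp add: right_diff_distrib)
    \<comment> \<open>The roles are exchanged: dropping neighbours now bounds \<open>G t\<close>
      from above, and restoring them on the event \<open>X \<alpha>\<close> costs the joint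
      probabilities.\<close>
    have "G t \<le> mean \<Omega> (\<lambda>\<omega>. t ^ V \<alpha> \<omega>)" unfolding G_def
      using t W_split[OF \<alpha>] by (intro mean_mono) (auto intro!: power_decreasing)
    then have "p \<alpha> * G t \<le> p \<alpha> * mean \<Omega> (\<lambda>\<omega>. t ^ V \<alpha> \<omega>)"
      using p_nonneg[OF \<alpha>] by (rule mult_left_mono)
    moreover have "mean \<Omega> (\<lambda>\<omega>. of_bool (X \<alpha> \<omega>) * t ^ V \<alpha> \<omega>)
        - (\<Sum>\<beta>\<in>N \<alpha> - {\<alpha>}. mean \<Omega> (\<lambda>\<omega>. of_bool (X \<alpha> \<omega>) * of_bool (X \<beta> \<omega>)))
        \<le> mean \<Omega> (\<lambda>\<omega>. of_bool (X \<alpha> \<omega>) * t ^ (W \<omega> - 1))"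
    proof -
      have "finite (N \<alpha> - {\<alpha>})" using finN[OF \<alpha>] by simp
      note c = real_card_filter[OF this, symmetric]
      show ?thesis
        unfolding mean_sum[symmetric] mean_diff[symmetric] sum_distrib_left[symmetric] c
        using t W_pred[OF \<alpha>] power_add_ge_minus[of t]
        by (intro mean_mono) (auto simp: of_bool_def simp del: One_nat_def)
    qed
    ultimately show "- (\<Sum>\<beta>\<in>N \<alpha> - {\<alpha>}. mean \<Omega> (\<lambda>\<omega>. of_bool (X \<alpha> \<omega>) * of_bool (X \<beta> \<omega>)))
       \<le> mean \<Omega> (\<lambda>\<omega>. of_bool (X \<alpha> \<omega>) * t ^ (W \<omega> - 1)) - p \<alpha> * G t"
      using ind by simp
  qed
  have G'_bounds: "G' t - lam * G t \<le> b1" "- b2 \<le> G' t - lam * G t" if t: "0 < t" "t < 1" for t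
  proof -
    have eq: "G' t - lam * G t = (\<Sum>\<alpha>\<in>J. mean \<Omega> (\<lambda>\<omega>. of_bool (X \<alpha> \<omega>) * t ^ (W \<omega> - 1)) - p \<alpha> * G t)"
      by (simp add: G'_eq lam_def sum_subtractf sum_distrib_right)
    show "G' t - lam * G t \<le> b1" unfolding eq b1_def using term_bounds t by (intro sum_mono) auto
    show "- b2 \<le> G' t - lam * G t" unfolding eq b2_def
      using term_bounds(2)[OF _ t] by (subst sum_negf[symmetric]) (rule sum_mono)
  qed
  have deriv: "((\<lambda>t. G t * exp (- lam * t)) has_real_derivative (G' t - lam * G t) * exp (- lam * t)) (at t)" for t
  proof -
    have "(G has_real_derivative G' t) (at t)"
      unfolding G_def G'_def mean_def One_nat_def by (intro DERIV_cdivide DERIV_sum DERIV_pow)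
    then show ?thesis by (auto intro!: derivative_eq_intros simp: algebra_simps)
  qed
  obtain z where z: "0 < z" "z < 1"
    and mvt: "G 1 * exp (- lam * 1) - G 0 * exp (- lam * 0) = (1 - 0) * ((G' z - lam * G z) * exp (- lam * z))"
    using MVT2[of 0 1 "\<lambda>t. G t * exp (- lam * t)" "\<lambda>t. (G' t - lam * G t) * exp (- lam * t)"] deriv
    by auto
  have "G 1 = 1" using \<Omega> by (simp add: G_def mean_const)
  \<comment> \<open>Since \<open>0 ^ 0 = 1\<close>, exactly the outcomes without any event
    contribute.\<close>
  moreover have "G 0 = mean \<Omega> (\<lambda>\<omega>. of_bool (\<forall>\<alpha>\<in>J. \<not> X \<alpha> \<omega>))"
    unfolding G_def W_def using J by (intro mean_cong) (auto simp: power_0_left)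
  ultimately have D: "D = (G' z - lam * G z) * exp (- lam * z)"
    using mvt by (simp add: D_def lam_def)
  have e: "0 \<le> exp (- lam * z)" "exp (- lam * z) \<le> 1" using lam_nonneg z by auto
  have "D \<le> b1 * exp (- lam * z)" unfolding D using G'_bounds[OF z] e by (intro mult_right_mono) auto
  also have "\<dots> \<le> b1" using e b1_nonneg by (simp add: mult_left_le)
  finally show "D \<le> (\<Sum>\<alpha>\<in>J. \<Sum>\<beta>\<in>N \<alpha>. p \<alpha> * p \<beta>)" unfolding b1_def .
  have "- D \<le> b2 * exp (- lam * z)" unfolding D
    using mult_right_mono[OF G'_bounds(2)[OF z] e(1)] by simp
  also have "\<dots> \<le> b2" using e b2_nonneg by (simp add: mult_left_le)
  finally show "- D \<le> (\<Sum>\<alpha>\<in>J. \<Sum>\<beta>\<in>N \<alpha> - {\<alpha>}. mean \<Omega> (\<lambda>\<omega>. of_bool (X \<alpha> \<omega>) * of_bool (X \<beta> \<omega>)))"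
    unfolding b2_def .
qed

section \<open>Collisions in random words\<close>

definition words :: "'a set \<Rightarrow> nat \<Rightarrow> 'a list set" where
  "words E r = {xs. set xs \<subseteq> E \<and> length xs = r}"

lemma finite_words: "finite E \<Longrightarrow> finite (words E r)"
  unfolding words_def by (rule finite_lists_length_eq)

lemma card_words: "finite E \<Longrightarrow> card (words E r) = card E ^ r"
  unfolding words_def by (rule card_lists_length_eq)

lemma words_nonempty: "E \<noteq> {} \<Longrightarrow> words E r \<noteq> {}"
  unfolding words_def by (metis (mono_tags) Collect_empty_eq all_not_in_conv empty_subsetI
      length_replicate set_replicate_conv_if insert_subset)

text \<open>Replacing one letter by an independent uniform letter preserves the uniform law on
  words. Used once per relevant position, this turns an average over words into iterated averages
  over \<open>E\<close>.\<close>

lemma mean_words_resample: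
  assumes "finite E" "E \<noteq> {}" "a < r"
  shows "mean (words E r) F = mean (words E r) (\<lambda>xs. mean E (\<lambda>e. F (xs[a := e])))"
proof -
  have "(\<Sum>xs\<in>words E r. \<Sum>e\<in>E. F (xs[a := e])) = (\<Sum>(xs, e)\<in>words E r \<times> E. F (xs[a := e]))"
    by (rule sum.cartesian_product)
  also have "\<dots> = (\<Sum>(xs, e)\<in>words E r \<times> E. F xs)"
    \<comment> \<open>swapping the letter at position \<open>a\<close> with \<open>e\<close> is an involution\<close>
    using \<open>a < r\<close>
    by (intro sum.reindex_bij_witness[where i = "\<lambda>(xs, e). (xs[a := e], xs ! a)"
          and j = "\<lambda>(xs, e). (xs[a := e], xs ! a)"])
      (auto simp: words_def dest: set_update_subset_insert[THEN subsetD])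
  also have "\<dots> = real (card E) * (\<Sum>xs\<in>words E r. F xs)"
    by (simp add: sum.cartesian_product[symmetric] sum_distrib_left)
  finally show ?thesis using assms by (simp add: mean_def sum_divide_distrib[symmetric])
qed

text \<open>The conditional collision probability given one of the two letters. Its mean is the
  probability of one collision; its second moment is that of two collisions sharing a
  position.\<close>

definition coll :: "'a set \<Rightarrow> ('a \<Rightarrow> 'b) \<Rightarrow> 'a \<Rightarrow> real" where
  "coll E \<phi> e = mean E (\<lambda>e'. of_bool (\<phi> e = \<phi> e'))"

text \<open>Positions form a set rather than an ordered pair, so that every unordered pair is a
  single index.\<close>

definition agree :: "nat set \<times> ('a \<Rightarrow> 'b) \<Rightarrow> 'a list \<Rightarrow> bool" where
  "agree \<alpha> xs \<longleftrightarrow> (\<forall>a\<in>fst \<alpha>. \<forall>b\<in>fst \<alpha>. snd \<alpha> (xs ! a) = snd \<alpha> (xs ! b))"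

lemma agree_pair: "agree ({a, b}, \<phi>) xs \<longleftrightarrow> \<phi> (xs ! a) = \<phi> (xs ! b)"
  by (auto simp: agree_def)

lemma agree_update: "a \<notin> fst \<alpha> \<Longrightarrow> agree \<alpha> (xs[a := e]) \<longleftrightarrow> agree \<alpha> xs"
  unfolding agree_def by (metis nth_list_update_neq)

text \<open>Resampling positions \<open>a\<close> and \<open>b\<close> leaves \<open>F\<close> alone
  and averages the indicator to a constant, whatever the rest of the word is.\<close>

lemma mean_agree_times:
  assumes E: "finite E" "E \<noteq> {}" and ab: "a < r" "b < r" "a \<noteq> b"
    and inv: "\<And>xs e. F (xs[a := e]) = F xs" "\<And>xs e. F (xs[b := e]) = F xs"
  shows "mean (words E r) (\<lambda>xs. of_bool (agree ({a, b}, \<phi>) xs) * F xs)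
    = mean E (coll E \<phi>) * mean (words E r) F"
proof -
  have "mean (words E r) (\<lambda>xs. of_bool (agree ({a, b}, \<phi>) xs) * F xs)
    = mean (words E r) (\<lambda>xs. mean E (\<lambda>e. mean E (\<lambda>e'.
        of_bool (agree ({a, b}, \<phi>) (xs[a := e, b := e'])) * F (xs[a := e, b := e']))))"
    by (subst mean_words_resample[OF E ab(2)], subst mean_words_resample[OF E ab(1)]) simp
  also have "\<dots> = mean (words E r) (\<lambda>xs. mean E (coll E \<phi>) * F xs)"
    unfolding inv coll_def mean_multc using ab
    by (intro mean_cong) (simp add: words_def agree_pair)
  finally show ?thesis by (simp add: mean_cmult)
qed

lemma mean_agree_same:
  assumes E: "finite E" "E \<noteq> {}" and ab: "a < r" "b < r" "a \<noteq> b"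
  shows "mean (words E r) (\<lambda>xs. of_bool (agree ({a, b}, \<phi>) xs) * of_bool (agree ({a, b}, \<psi>) xs))
    = mean E (\<lambda>e. mean E (\<lambda>e'. of_bool (\<phi> e = \<phi> e' \<and> \<psi> e = \<psi> e')))"
proof -
  have "mean (words E r) (\<lambda>xs. of_bool (agree ({a, b}, \<phi>) xs) * of_bool (agree ({a, b}, \<psi>) xs))
    = mean (words E r) (\<lambda>xs. mean E (\<lambda>e. mean E (\<lambda>e'.
        of_bool (agree ({a, b}, \<phi>) (xs[a := e, b := e'])) * of_bool (agree ({a, b}, \<psi>) (xs[a := e, b := e'])))))"
    by (subst mean_words_resample[OF E ab(2)], subst mean_words_resample[OF E ab(1)]) simp
  also have "\<dots> = mean (words E r) (\<lambda>xs. mean E (\<lambda>e. mean E (\<lambda>e'. of_bool (\<phi> e = \<phi> e' \<and> \<psi> e = \<psi> e'))))"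
    using ab by (intro mean_cong) (simp add: words_def agree_pair)
  finally show ?thesis by (simp add: mean_const finite_words words_nonempty E)
qed

text \<open>Given the letter at the shared position \<open>a\<close>, the two collisions depend on
  different independent letters, so their conditional probabilities multiply.\<close>

lemma mean_agree_adjacent:
  assumes E: "finite E" "E \<noteq> {}" and abc: "a < r" "b < r" "c < r" "a \<noteq> b" "a \<noteq> c" "b \<noteq> c"
  shows "mean (words E r) (\<lambda>xs. of_bool (agree ({a, b}, \<phi>) xs) * of_bool (agree ({a, c}, \<psi>) xs))
    = mean E (\<lambda>e. coll E \<phi> e * coll E \<psi> e)"
proof -
  have "mean (words E r) (\<lambda>xs. of_bool (agree ({a, b}, \<phi>) xs) * of_bool (agree ({a, c}, \<psi>) xs))
    = mean (words E r) (\<lambda>xs. mean E (\<lambda>e. mean E (\<lambda>e'. mean E (\<lambda>e''.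
        of_bool (agree ({a, b}, \<phi>) (xs[a := e, b := e', c := e''])) *
        of_bool (agree ({a, c}, \<psi>) (xs[a := e, b := e', c := e'']))))))"
    by (subst mean_words_resample[OF E abc(3)], subst mean_words_resample[OF E abc(2)],
        subst mean_words_resample[OF E abc(1)]) simp
  also have "\<dots> = mean (words E r) (\<lambda>xs. mean E (\<lambda>e. mean E (\<lambda>e'. mean E (\<lambda>e''.
        of_bool (\<phi> e = \<phi> e') * of_bool (\<psi> e = \<psi> e'')))))"
    using abc by (intro mean_cong) (simp add: words_def agree_pair)
  finally show ?thesis
    by (simp add: mean_const finite_words words_nonempty E mean_cmult mean_multc coll_def)
qed

text \<open>By 2xy \<le> x^2 + y^2, bounds on the second moments of the two features also cover
  collisions in mixed features.\<close>

lemma mean_coll_mult_le: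
  assumes "mean E (\<lambda>e. (coll E \<phi> e)\<^sup>2) \<le> q" "mean E (\<lambda>e. (coll E \<psi> e)\<^sup>2) \<le> q"
  shows "mean E (\<lambda>e. coll E \<phi> e * coll E \<psi> e) \<le> q"
proof -
  have "2 * mean E (\<lambda>e. coll E \<phi> e * coll E \<psi> e)
      \<le> mean E (\<lambda>e. (coll E \<phi> e)\<^sup>2 + (coll E \<psi> e)\<^sup>2)"
    unfolding mean_cmult[symmetric]
    by (intro mean_mono) (use sum_squares_bound in \<open>simp add: mult.assoc\<close>)
  with assms show ?thesis by (simp add: mean_add)
qed

text \<open>Besides \<open>s\<close> itself, each of its two points lies in \<open>r - 2\<close>
  further pairs, and 1 + 2(r - 2) = 2r - 3. Since \<open>s\<close> exists, \<open>r \<ge> 2\<close>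
  and the subtraction is not truncated.\<close>

lemma card_doubletons_meeting:
  assumes s: "s \<subseteq> {..<r}" "card s = 2"
  shows "card {s'. s' \<subseteq> {..<r} \<and> card s' = 2 \<and> s' \<inter> s \<noteq> {}} \<le> 2 * r - 3"
proof -
  obtain a b where ab: "s = {a, b}" "a \<noteq> b" using s(2) by (auto simp: card_2_iff)
  have fs: "finite s" using ab by simp
  let ?C = "{..<r} - s"
  have c: "card ?C = r - 2" using s fs by (simp add: card_Diff_subset)
  have "2 \<le> r" using card_mono[OF _ s(1)] s(2) by simp
  have "{s'. s' \<subseteq> {..<r} \<and> card s' = 2 \<and> s' \<inter> s \<noteq> {}}
     \<subseteq> insert s ((\<lambda>c. {a, c}) ` ?C \<union> (\<lambda>c. {b, c}) ` ?C)"
    using ab by (auto simp: card_2_iff image_iff doubleton_eq_iff)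
  then have "card {s'. s' \<subseteq> {..<r} \<and> card s' = 2 \<and> s' \<inter> s \<noteq> {}}
     \<le> card (insert s ((\<lambda>c. {a, c}) ` ?C \<union> (\<lambda>c. {b, c}) ` ?C))"
    by (intro card_mono) auto
  also have "\<dots> \<le> Suc (card ((\<lambda>c. {a, c}) ` ?C \<union> (\<lambda>c. {b, c}) ` ?C))"
    by (rule card_insert_le_m1) auto
  also have "\<dots> \<le> Suc (card ((\<lambda>c. {a, c}) ` ?C) + card ((\<lambda>c. {b, c}) ` ?C))"
    using card_Un_le by auto
  also have "\<dots> \<le> Suc ((r - 2) + (r - 2))"
    using card_image_le[of ?C "\<lambda>c. {a, c}"] card_image_le[of ?C "\<lambda>c. {b, c}"] c by simp
  finally show ?thesis using \<open>2 \<le> r\<close> by simp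
qed

text \<open>An event is a pair of positions together with a feature, and two events are neighbours
  when their pairs meet, whatever the features. There are \<open>m\<close> events with at most
  \<open>M\<close> neighbours each, counting the event itself; the joint probabilities omit it,
  whence \<open>M - 1\<close>.\<close>

lemma distinct_words_poisson:
  fixes E :: "'a set" and \<Phi> :: "('a \<Rightarrow> 'b) set" and r :: nat
  assumes E: "finite E" "E \<noteq> {}" and \<Phi>: "finite \<Phi>"
    and p: "\<And>\<phi>. \<phi> \<in> \<Phi> \<Longrightarrow> mean E (coll E \<phi>) = p"
    and q: "\<And>\<phi>. \<phi> \<in> \<Phi> \<Longrightarrow> mean E (\<lambda>e. (coll E \<phi> e)\<^sup>2) \<le> q"
    and q': "\<And>\<phi> \<psi>. \<phi> \<in> \<Phi> \<Longrightarrow> \<psi> \<in> \<Phi> \<Longrightarrow> \<phi> \<noteq> \<psi> \<Longrightarrow>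
      mean E (\<lambda>e. mean E (\<lambda>e'. of_bool (\<phi> e = \<phi> e' \<and> \<psi> e = \<psi> e'))) \<le> q"
  defines "m \<equiv> (r choose 2) * card \<Phi>" and "M \<equiv> (2 * r - 3) * card \<Phi>"
  defines "D \<equiv> exp (- (real m * p))
    - real (card {xs\<in>words E r. \<forall>\<phi>\<in>\<Phi>. distinct (map \<phi> xs)}) / real (card E) ^ r"
  shows "D \<le> real m * real M * p\<^sup>2" and "- D \<le> real m * real (M - 1) * q"
proof -
  define T where "T = {s. s \<subseteq> {..<r} \<and> card s = 2}"
  define J where "J = T \<times> \<Phi>"
  define nb where "nb \<alpha> = {\<beta>\<in>J. fst \<beta> \<inter> fst \<alpha> \<noteq> {}}" for \<alpha> :: "nat set \<times> ('a \<Rightarrow> 'b)"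
  have finT: "finite T" unfolding T_def by (rule finite_subset[of _ "Pow {..<r}"]) auto
  have cardT: "card T = r choose 2" unfolding T_def by (simp add: n_subsets)
  have finJ: "finite J" using finT \<Phi> by (simp add: J_def)
  have cardJ: "card J = m" by (simp add: J_def m_def cardT card_cartesian_product)
  have pair: "\<exists>a b. s = {a, b} \<and> a < r \<and> b < r \<and> a \<noteq> b" if "s \<in> T" for s
    using that by (auto simp: T_def card_2_iff)
  have pairJ: "\<exists>a b \<phi>. \<alpha> = ({a, b}, \<phi>) \<and> a < r \<and> b < r \<and> a \<noteq> b \<and> \<phi> \<in> \<Phi>" if "\<alpha> \<in> J" for \<alpha>
    using that pair by (cases \<alpha>) (fastforce simp: J_def)
  have nb_refl: "\<alpha> \<in> nb \<alpha>" if "\<alpha> \<in> J" for \<alpha>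
    using that pairJ[OF that] by (auto simp: nb_def)
  have nb_sub: "nb \<alpha> \<subseteq> J" for \<alpha> by (auto simp: nb_def)
  have fin_nb: "finite (nb \<alpha>)" for \<alpha> using finJ nb_sub finite_subset by blast
  have card_nb: "card (nb \<alpha>) \<le> M" if "\<alpha> \<in> J" for \<alpha>
  proof -
    have "nb \<alpha> = {s'. s' \<subseteq> {..<r} \<and> card s' = 2 \<and> s' \<inter> fst \<alpha> \<noteq> {}} \<times> \<Phi>"
      by (auto simp: nb_def J_def T_def)
    then show ?thesis using that card_doubletons_meeting[of "fst \<alpha>" r]
      by (auto simp: M_def card_cartesian_product J_def T_def)
  qed
  have indep: "mean (words E r) (\<lambda>xs. of_bool (agree \<alpha> xs) * t ^ card {\<beta>\<in>J - nb \<alpha>. agree \<beta> xs})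
        = p * mean (words E r) (\<lambda>xs. t ^ card {\<beta>\<in>J - nb \<alpha>. agree \<beta> xs})"
    if in_J: "\<alpha> \<in> J" for \<alpha> t
  proof -
    obtain a b \<phi> where \<alpha>: "\<alpha> = ({a, b}, \<phi>)" "a < r" "b < r" "a \<noteq> b" "\<phi> \<in> \<Phi>"
      using pairJ[OF in_J] by blast
    have "{\<beta>\<in>J - nb \<alpha>. agree \<beta> (xs[c := e])} = {\<beta>\<in>J - nb \<alpha>. agree \<beta> xs}" if "c \<in> {a, b}" for c xs e
    proof -
      have "agree \<beta> (xs[c := e]) \<longleftrightarrow> agree \<beta> xs" if "\<beta> \<in> J - nb \<alpha>" for \<beta>
        using that \<open>c \<in> {a, b}\<close> by (intro agree_update) (auto simp: nb_def \<alpha>(1))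
      then show ?thesis by blast
    qed
    then show ?thesis unfolding \<alpha>(1) p[OF \<alpha>(5), symmetric]
      using \<alpha> by (intro mean_agree_times E) auto
  qed
  have joint: "mean (words E r) (\<lambda>xs. of_bool (agree \<alpha> xs) * of_bool (agree \<beta> xs)) \<le> q"
    if \<alpha>: "\<alpha> \<in> J" and \<beta>: "\<beta> \<in> nb \<alpha> - {\<alpha>}" for \<alpha> \<beta>
  proof -
    obtain s \<phi> where \<alpha>_eq: "\<alpha> = (s, \<phi>)" "s \<in> T" "\<phi> \<in> \<Phi>" using \<alpha> by (auto simp: J_def)
    obtain s' \<psi> where \<beta>_eq: "\<beta> = (s', \<psi>)" "s' \<in> T" "\<psi> \<in> \<Phi>" "s' \<inter> s \<noteq> {}"
      using \<beta> \<alpha>_eq(1) unfolding nb_def J_def by (cases \<beta>) simp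
    show ?thesis
    \<comment> \<open>Equal position pairs force different features, which is the case of
      \<open>q'\<close>; otherwise exactly one position is shared.\<close>
    proof (cases "s' = s")
      case True
      obtain a b where ab: "s = {a, b}" "a < r" "b < r" "a \<noteq> b" using pair[OF \<alpha>_eq(2)] by blast
      have "\<phi> \<noteq> \<psi>" using True \<beta> \<alpha>_eq \<beta>_eq by auto
      then have "mean (words E r) (\<lambda>xs. of_bool (agree ({a, b}, \<phi>) xs) * of_bool (agree ({a, b}, \<psi>) xs)) \<le> q"
        unfolding mean_agree_same[OF E ab(2-4)] using \<alpha>_eq \<beta>_eq by (intro q')
      then show ?thesis using True \<alpha>_eq(1) \<beta>_eq(1) ab(1) by simp
    next
      case False
      obtain a where a: "a \<in> s" "a \<in> s'" using \<beta>_eq(4) by blast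
      have "\<exists>b. s = {a, b} \<and> a < r \<and> b < r \<and> a \<noteq> b" using pair[OF \<alpha>_eq(2)] a(1) by auto
      then obtain b where b: "s = {a, b}" "a < r" "b < r" "a \<noteq> b" by blast
      have "\<exists>c. s' = {a, c} \<and> c < r \<and> a \<noteq> c" using pair[OF \<beta>_eq(2)] a(2) by auto
      then obtain c where c: "s' = {a, c}" "c < r" "a \<noteq> c" by blast
      have "b \<noteq> c" using False b c by auto
      then show ?thesis
        using mean_agree_adjacent[OF E b(2,3) c(2) b(4) c(3), of \<phi> \<psi>]
          mean_coll_mult_le[OF q[OF \<alpha>_eq(3)] q[OF \<beta>_eq(3)]] \<alpha>_eq(1) \<beta>_eq(1) b(1) c(1) by simp
    qed
  qed
  have zero: "(\<forall>\<alpha>\<in>J. \<not> agree \<alpha> xs) \<longleftrightarrow> (\<forall>\<phi>\<in>\<Phi>. distinct (map \<phi> xs))" if "length xs = r" for xs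
  proof
    assume none: "\<forall>\<alpha>\<in>J. \<not> agree \<alpha> xs"
    show "\<forall>\<phi>\<in>\<Phi>. distinct (map \<phi> xs)"
    proof
      fix \<phi> assume "\<phi> \<in> \<Phi>"
      then have "({a, b}, \<phi>) \<in> J" if "a < r" "b < r" "a \<noteq> b" for a b
        using that by (auto simp: J_def T_def)
      with none have "\<phi> (xs ! a) \<noteq> \<phi> (xs ! b)" if "a < r" "b < r" "a \<noteq> b" for a b
        using that agree_pair by blast
      then show "distinct (map \<phi> xs)" using that by (auto simp: distinct_conv_nth)
    qed
  next
    assume *: "\<forall>\<phi>\<in>\<Phi>. distinct (map \<phi> xs)"
    show "\<forall>\<alpha>\<in>J. \<not> agree \<alpha> xs"
    proof
      fix \<alpha> assume "\<alpha> \<in> J"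
      then obtain a b \<phi> where "\<alpha> = ({a, b}, \<phi>)" "a < r" "b < r" "a \<noteq> b" "\<phi> \<in> \<Phi>"
        using pairJ by blast
      then show "\<not> agree \<alpha> xs" using * that by (auto simp: distinct_conv_nth agree_pair)
    qed
  qed
  have zero_mean: "mean (words E r) (\<lambda>xs. of_bool (\<forall>\<alpha>\<in>J. \<not> agree \<alpha> xs))
    = real (card {xs\<in>words E r. \<forall>\<phi>\<in>\<Phi>. distinct (map \<phi> xs)}) / real (card E) ^ r"
  proof -
    have "{xs\<in>words E r. \<forall>\<alpha>\<in>J. \<not> agree \<alpha> xs} = {xs\<in>words E r. \<forall>\<phi>\<in>\<Phi>. distinct (map \<phi> xs)}"
      using zero by (auto simp: words_def)
    then show ?thesis using E by (simp add: mean_of_bool finite_words card_words)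
  qed
  have D: "D = exp (- (\<Sum>\<alpha>\<in>J. p)) - mean (words E r) (\<lambda>xs. of_bool (\<forall>\<alpha>\<in>J. \<not> agree \<alpha> xs))"
    unfolding D_def zero_mean by (simp add: cardJ)
  have "D \<le> (\<Sum>\<alpha>\<in>J. \<Sum>\<beta>\<in>nb \<alpha>. p * p)" unfolding D
    by (intro stein_poisson_zero(1)[where N = nb and p = "\<lambda>_. p"] finite_words words_nonempty finJ nb_refl nb_sub indep E)
  also have "\<dots> \<le> (\<Sum>\<alpha>\<in>J. real M * (p * p))"
  proof (rule sum_mono)
    fix \<alpha> assume "\<alpha> \<in> J"
    then show "(\<Sum>\<beta>\<in>nb \<alpha>. p * p) \<le> real M * (p * p)"
      using card_nb by (simp add: mult_right_mono)
  qed
  finally show "D \<le> real m * real M * p\<^sup>2" by (simp add: cardJ power2_eq_square mult.assoc)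
  have "- D \<le> (\<Sum>\<alpha>\<in>J. \<Sum>\<beta>\<in>nb \<alpha> - {\<alpha>}.
      mean (words E r) (\<lambda>xs. of_bool (agree \<alpha> xs) * of_bool (agree \<beta> xs)))"
    unfolding D
    by (intro stein_poisson_zero(2)[where N = nb and p = "\<lambda>_. p"] finite_words words_nonempty finJ nb_refl nb_sub indep E)
  also have "\<dots> \<le> (\<Sum>\<alpha>\<in>J. real (M - 1) * q)"
  proof (intro sum_mono)
    fix \<alpha> assume \<alpha>: "\<alpha> \<in> J"
    \<comment> \<open>Nonnegativity of \<open>q\<close> allows the neighbourhood size to be replaced
      by its upper bound.\<close>
    have "0 \<le> mean E (\<lambda>e. (coll E (snd \<alpha>) e)\<^sup>2)" by (intro mean_nonneg) auto
    also have "\<dots> \<le> q" using \<alpha> by (intro q) (auto simp: J_def)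
    finally have "0 \<le> q" .
    have "(\<Sum>\<beta>\<in>nb \<alpha> - {\<alpha>}. mean (words E r) (\<lambda>xs. of_bool (agree \<alpha> xs) * of_bool (agree \<beta> xs)))
      \<le> real (card (nb \<alpha> - {\<alpha>})) * q"
      using joint[OF \<alpha>] by (intro sum_bounded_above) auto
    also have "\<dots> \<le> real (M - 1) * q"
      using card_nb[OF \<alpha>] nb_refl[OF \<alpha>] fin_nb[of \<alpha>] \<open>0 \<le> q\<close>
      by (intro mult_right_mono) (auto simp: card_Diff_singleton)
    finally show "(\<Sum>\<beta>\<in>nb \<alpha> - {\<alpha>}. mean (words E r) (\<lambda>xs. of_bool (agree \<alpha> xs) * of_bool (agree \<beta> xs)))
      \<le> real (M - 1) * q" .
  qed
  finally show "- D \<le> real m * real (M - 1) * q" by (simp add: cardJ)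
qed

section \<open>The staircase board\<close>

definition stair :: "nat \<Rightarrow> (nat \<times> nat) set" where
  "stair n = {(i, j). i < j \<and> j < n}"

lemma stair_0: "stair 0 = {}"
  by (auto simp: stair_def)

lemma stair_Suc: "stair (Suc n) = stair n \<union> (\<lambda>i. (i, n)) ` {..<n}"
  by (auto simp: stair_def)

lemma finite_stair: "finite (stair n)"
  by (induction n) (auto simp: stair_0 stair_Suc)

lemma stair_Suc_disjoint: "stair n \<inter> (\<lambda>i. (i, n)) ` {..<n} = {}"
  by (auto simp: stair_def)

lemma sum_stair_snd: "(\<Sum>e\<in>stair n. F (snd e)) = (\<Sum>j<n. real j * F j)"
proof (induction n)
  case (Suc n)
  have "(\<Sum>e\<in>(\<lambda>i. (i, n)) ` {..<n}. F (snd e)) = real n * F n"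
    by (subst sum.reindex) (auto simp: inj_on_def)
  with Suc show ?case
    by (simp add: stair_Suc sum.union_disjoint finite_stair stair_Suc_disjoint)
qed (simp add: stair_0)

text \<open>Row \<open>i\<close> has \<open>n - Suc i\<close> cells. Reversing the order of the rows
  matches the column lengths, so both features have the same moments.\<close>

lemma sum_stair_fst: "(\<Sum>e\<in>stair n. F (fst e)) = (\<Sum>j<n. real j * F (n - Suc j))"
proof -
  have "stair n = (SIGMA i:{..<n}. {Suc i..<n})" by (auto simp: stair_def)
  then have "(\<Sum>e\<in>stair n. F (fst e)) = (\<Sum>i<n. real (n - Suc i) * F i)"
    by (simp add: sum.Sigma[symmetric, where g = "\<lambda>i j. F i", simplified split_def])
  also have "\<dots> = (\<Sum>j<n. real j * F (n - Suc j))"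
    by (subst sum.nat_diff_reindex[symmetric]) (auto intro!: sum.cong)
  finally show ?thesis .
qed

lemma real_choose_two: "real (n choose 2) = real n * (real n - 1) / 2"
proof (induction n)
  case (Suc n)
  have "Suc n choose 2 = n + (n choose 2)" by (simp add: numeral_2_eq_2)
  with Suc show ?case by (simp add: field_simps)
qed simp

lemma card_stair: "card (stair n) = n choose 2"
proof (induction n)
  case (Suc n)
  have "card (stair (Suc n)) = card (stair n) + card ((\<lambda>i. (i, n)) ` {..<n})"
    unfolding stair_Suc by (intro card_Un_disjoint finite_stair stair_Suc_disjoint) auto
  also have "card ((\<lambda>i. (i, n)) ` {..<n}) = n" by (subst card_image) (auto simp: inj_on_def)
  finally show ?case using Suc by (simp add: numeral_2_eq_2)
qed (simp add: stair_0)

lemma sum_squares_lessThan: "(\<Sum>j<n. real j ^ 2) = real n * (real n - 1) * (2 * real n - 1) / 6"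
  by (induction n) (auto simp: field_simps power2_eq_square)

lemma sum_cubes_lessThan: "(\<Sum>j<n. real j ^ 3) = (real n * (real n - 1) / 2)\<^sup>2"
  by (induction n) (auto simp: field_simps power2_eq_square power3_eq_cube)

lemma coll_stair_snd:
  assumes "e \<in> stair n"
  shows "coll (stair n) snd e = real (snd e) / real (n choose 2)"
proof -
  have "{e'\<in>stair n. snd e = snd e'} = (\<lambda>i. (i, snd e)) ` {..<snd e}"
    using assms by (auto simp: stair_def)
  then have "card {e'\<in>stair n. snd e = snd e'} = snd e" by (simp add: card_image inj_on_def)
  then show ?thesis by (simp add: coll_def mean_of_bool finite_stair card_stair)
qed

lemma coll_stair_fst:
  assumes "e \<in> stair n"
  shows "coll (stair n) fst e = real (n - Suc (fst e)) / real (n choose 2)"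
proof -
  have "{e'\<in>stair n. fst e = fst e'} = (\<lambda>j. (fst e, j)) ` {Suc (fst e)..<n}"
    using assms by (auto simp: stair_def)
  then have "card {e'\<in>stair n. fst e = fst e'} = n - Suc (fst e)" by (simp add: card_image inj_on_def)
  then show ?thesis by (simp add: coll_def mean_of_bool finite_stair card_stair)
qed

text \<open>A line with \<open>j\<close> cells contributes \<open>j\<close> cells, each with
  collision probability \<open>j / (n choose 2)\<close>. The case \<open>k = 1\<close> gives the
  mean, and \<open>k = 2\<close> leads to the sum of cubes.\<close>

lemma mean_coll_stair_power:
  assumes "\<phi> \<in> {fst, snd}"
  shows "mean (stair n) (\<lambda>e. coll (stair n) \<phi> e ^ k) = (\<Sum>j<n. real j ^ Suc k) / real (n choose 2) ^ Suc k"
proof -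
  have "(\<Sum>e\<in>stair n. coll (stair n) snd e ^ k) = (\<Sum>e\<in>stair n. (real (snd e) / real (n choose 2)) ^ k)"
    by (intro sum.cong) (simp_all add: coll_stair_snd)
  also have "\<dots> = (\<Sum>j<n. real j * (real j / real (n choose 2)) ^ k)" by (rule sum_stair_snd)
  finally have s: "(\<Sum>e\<in>stair n. coll (stair n) snd e ^ k) = \<dots>" .
  have "(\<Sum>e\<in>stair n. coll (stair n) fst e ^ k) = (\<Sum>e\<in>stair n. (real (n - Suc (fst e)) / real (n choose 2)) ^ k)"
    by (intro sum.cong) (simp_all add: coll_stair_fst)
  also have "\<dots> = (\<Sum>j<n. real j * (real (n - Suc (n - Suc j)) / real (n choose 2)) ^ k)" by (rule sum_stair_fst)
  also have "\<dots> = (\<Sum>j<n. real j * (real j / real (n choose 2)) ^ k)" by (intro sum.cong) auto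
  finally have "(\<Sum>e\<in>stair n. coll (stair n) \<phi> e ^ k) = (\<Sum>j<n. real j * (real j / real (n choose 2)) ^ k)"
    using s assms by auto
  then show ?thesis
    by (simp add: mean_def card_stair power_divide sum_divide_distrib mult.commute)
qed

lemma mean_coll_stair:
  assumes "\<phi> \<in> {fst, snd}" "n \<ge> 2"
  shows "mean (stair n) (coll (stair n) \<phi>) = 4/3 * (real n - 1/2) / (real n * (real n - 1))"
  using mean_coll_stair_power[OF assms(1), of n 1] assms(2)
  by (simp add: sum_squares_lessThan[unfolded power2_eq_square] real_choose_two)

lemma mean_coll_stair_sq:
  assumes "\<phi> \<in> {fst, snd}" "n \<ge> 2"
  shows "mean (stair n) (\<lambda>e. (coll (stair n) \<phi> e)\<^sup>2) = 1 / real (n choose 2)"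
proof -
  have nz: "real (n choose 2) \<noteq> 0" using assms(2) unfolding real_choose_two by simp
  have "mean (stair n) (\<lambda>e. (coll (stair n) \<phi> e)\<^sup>2) = (\<Sum>j<n. real j ^ 3) / real (n choose 2) ^ 3"
    using mean_coll_stair_power[OF assms(1), of n 2] by (simp add: numeral_2_eq_2 numeral_3_eq_3)
  also have "\<dots> = (real (n choose 2))\<^sup>2 / real (n choose 2) ^ 3"
    by (simp only: sum_cubes_lessThan real_choose_two)
  also have "\<dots> = 1 / real (n choose 2)"
    using nz by (simp add: power2_eq_square power3_eq_cube)
  finally show ?thesis .
qed

text \<open>Agreement in both row and column means equality of cells, so this is the joint
  probability for one position pair with both features.\<close>

lemma mean_eq_stair:
  "mean (stair n) (\<lambda>e. mean (stair n) (\<lambda>e'. of_bool (e = e'))) \<le> 1 / real (n choose 2)"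
proof -
  have "mean (stair n) (\<lambda>e. mean (stair n) (\<lambda>e'. of_bool (e = e'))) = mean (stair n) (\<lambda>e. 1 / real (n choose 2))"
  proof (rule mean_cong)
    fix e assume "e \<in> stair n"
    then have "{e'\<in>stair n. e = e'} = {e}" by auto
    then show "mean (stair n) (\<lambda>e'. of_bool (e = e')) = 1 / real (n choose 2)"
      by (simp add: mean_of_bool finite_stair card_stair)
  qed
  then show ?thesis by (simp add: mean_def)
qed

section \<open>Rook placements and the Stirling recurrences\<close>

text \<open>With \<open>b\<close> these are non-attacking rooks, for the second kind; without
  \<open>b\<close> rooks may share a row, for the first kind.\<close>

definition rooks :: "bool \<Rightarrow> nat \<Rightarrow> nat \<Rightarrow> (nat \<times> nat) set set" where
  "rooks b n r = {S. S \<subseteq> stair n \<and> card S = r \<and> inj_on snd S \<and> (b \<longrightarrow> inj_on fst S)}"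

lemma finite_rooks: "finite (rooks b n r)"
  unfolding rooks_def by (rule finite_subset[of _ "Pow (stair n)"]) (auto simp: finite_stair)

lemma rooks_finite_member: "S \<in> rooks b n r \<Longrightarrow> finite S"
  unfolding rooks_def by (blast intro: finite_subset[OF _ finite_stair])

lemma rooks_0: "rooks b n 0 = {{}}"
proof -
  have "S = {}" if "S \<in> rooks b n 0" for S
    using that rooks_finite_member[OF that] by (simp add: rooks_def)
  moreover have "{} \<in> rooks b n 0" by (simp add: rooks_def)
  ultimately show ?thesis by blast
qed

lemma rooks_empty_board: "rooks b 0 (Suc r) = {}"
  by (auto simp: rooks_def stair_0)

text \<open>Either the new column \<open>n\<close> is empty or it holds one rook, in any row if rows
  may repeat and in an unoccupied row otherwise.\<close>

lemma rooks_Suc: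
  "rooks b (Suc n) (Suc r) = rooks b n (Suc r) \<union>
     (\<lambda>(S, i). insert (i, n) S) ` (SIGMA S:rooks b n r. {..<n} - (if b then fst ` S else {}))"
  (is "?L = ?A \<union> ?f ` ?B")
proof (intro equalityI subsetI)
  fix S assume S: "S \<in> ?L"
  then have fin: "finite S" by (rule rooks_finite_member)
  show "S \<in> ?A \<union> ?f ` ?B"
  proof (cases "\<exists>i. (i, n) \<in> S")
    case False
    then have "S \<subseteq> stair n" using S by (fastforce simp: rooks_def stair_Suc)
    then show ?thesis using S by (auto simp: rooks_def)
  next
    case True
    then obtain i where i: "(i, n) \<in> S" by blast
    have "i < n" using i S by (auto simp: rooks_def stair_def)
    have inj: "inj_on snd S" using S by (simp add: rooks_def)
    \<comment> \<open>Columns are distinct, so no other rook lies in column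
      \<open>n\<close>.\<close>
    have sub: "S - {(i, n)} \<subseteq> stair n"
    proof
      fix e assume e: "e \<in> S - {(i, n)}"
      have "snd e \<noteq> snd (i, n)" using inj_onD[OF inj, of e "(i, n)"] e i by auto
      then show "e \<in> stair n" using e S by (auto simp: rooks_def stair_Suc)
    qed
    have "i \<notin> fst ` (S - {(i, n)})" if b
    proof
      assume "i \<in> fst ` (S - {(i, n)})"
      then obtain e where e: "e \<in> S" "e \<noteq> (i, n)" "fst e = fst (i, n)" by auto
      have "inj_on fst S" using S that by (simp add: rooks_def)
      then show False using inj_onD e i by metis
    qed
    moreover have "S - {(i, n)} \<in> rooks b n r"
      using S sub i fin by (auto simp: rooks_def intro: inj_on_diff)
    ultimately have "(S - {(i, n)}, i) \<in> ?B" using \<open>i < n\<close> by auto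
    moreover have "S = ?f (S - {(i, n)}, i)" using i by auto
    ultimately show ?thesis by blast
  qed
next
  fix S assume "S \<in> ?A \<union> ?f ` ?B"
  then show "S \<in> ?L"
  proof
    assume "S \<in> ?A"
    then show ?thesis by (auto simp: rooks_def stair_Suc)
  next
    assume "S \<in> ?f ` ?B"
    then obtain U i where U: "U \<in> rooks b n r" "i < n" "b \<longrightarrow> i \<notin> fst ` U" "S = insert (i, n) U"
      by (auto split: if_splits)
    have "finite U" using U(1) by (rule rooks_finite_member)
    moreover have "n \<notin> snd ` U" using U by (auto simp: rooks_def stair_def)
    moreover from this have "(i, n) \<notin> U" by force
    ultimately show ?thesis using U by (auto simp: rooks_def stair_Suc)
  qed
qed

text \<open>With k = n - r, the multiplier is k if \<open>b\<close> holds and n if not: these are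
  the recurrences of the two kinds for index k in row n + 1.\<close>

lemma card_rooks_Suc:
  "card (rooks b (Suc n) (Suc r))
    = card (rooks b n (Suc r)) + card (rooks b n r) * (n - (if b then r else 0))"
proof -
  let ?f = "\<lambda>(S, i). insert (i, n) S"
  let ?B = "SIGMA S:rooks b n r. {..<n} - (if b then fst ` S else {})"
  have no_n: "(i, n) \<notin> S" if "S \<in> rooks b n r'" for S i r'
    using that by (auto simp: rooks_def stair_def)
  have "finite ?B" by (auto intro: finite_rooks)
  have "inj_on ?f ?B"
  proof (rule inj_onI, clarify)
    fix S i S' i'
    assume *: "S \<in> rooks b n r" "S' \<in> rooks b n r" "insert (i, n) S = insert (i', n) S'"
    then have "i = i'" using no_n by blast
    with * show "S = S' \<and> i = i'" using no_n by (metis insert_ident)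
  qed
  then have "card (?f ` ?B) = card ?B" by (rule card_image)
  also have "\<dots> = (\<Sum>S\<in>rooks b n r. card ({..<n} - (if b then fst ` S else {})))"
    by (rule card_SigmaI) (auto intro: finite_rooks)
  also have "\<dots> = (\<Sum>S\<in>rooks b n r. n - (if b then r else 0))"
  proof (rule sum.cong[OF refl])
    fix S assume S: "S \<in> rooks b n r"
    have "finite S" using S by (rule rooks_finite_member)
    moreover have "fst ` S \<subseteq> {..<n}" using S by (auto simp: rooks_def stair_def)
    ultimately show "card ({..<n} - (if b then fst ` S else {})) = n - (if b then r else 0)"
      using S by (auto simp: card_Diff_subset card_image rooks_def)
  qed
  finally have "card (?f ` ?B) = card (rooks b n r) * (n - (if b then r else 0))" by simp
  moreover have "card (rooks b (Suc n) (Suc r)) = card (rooks b n (Suc r)) + card (?f ` ?B)"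
    unfolding rooks_Suc using \<open>finite ?B\<close> no_n by (intro card_Un_disjoint finite_rooks) auto
  ultimately show ?thesis by simp
qed

lemma card_rooks:
  "card (rooks b n r) = (if r \<le> n then (if b then Stirling n (n - r) else stirling n (n - r)) else 0)"
proof (induction n arbitrary: r)
  case 0
  then show ?case by (cases r) (auto simp: rooks_0 rooks_empty_board)
next
  case (Suc n)
  show ?case
  proof (cases r)
    case 0
    then show ?thesis by (simp add: rooks_0)
  next
    case r: (Suc r')
    consider "r' < n" | "r' = n" | "r' > n" by linarith
    then show ?thesis
    proof cases
      case 1
      \<comment> \<open>Naming the successor makes the defining equations of both Stirling functions
        applicable.\<close>
      then obtain l where l: "n = Suc (r' + l)" using less_imp_Suc_add by blast
      then have "n - r' = Suc l" "n - Suc r' = l" by auto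
      then show ?thesis using 1 by (simp add: r card_rooks_Suc Suc.IH)
    next
      case 2
      \<comment> \<open>Column 0 has no cell, so \<open>n\<close> columns cannot all be used when
        \<open>n > 0\<close>; for \<open>n = 0\<close> the multiplier vanishes.\<close>
      have "card (rooks b n n) = 0 \<or> n = 0"
        using Suc.IH[of n] by (cases n) auto
      then show ?thesis using 2 by (auto simp: r card_rooks_Suc Suc.IH[of "Suc n"])
    next
      case 3
      then show ?thesis by (simp add: r card_rooks_Suc Suc.IH)
    qed
  qed
qed

text \<open>A word with distinct columns has distinct letters, so it lists a rook placement in one
  of its \<open>fact r\<close> orders.\<close>

lemma card_distinct_words:
  assumes "\<Phi> = (if b then {fst, snd} else {snd})"
  shows "card {xs\<in>words (stair n) r. \<forall>\<phi>\<in>\<Phi>. distinct (map \<phi> xs)} = fact r * card (rooks b n r)"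
proof -
  have "{xs\<in>words (stair n) r. \<forall>\<phi>\<in>\<Phi>. distinct (map \<phi> xs)} = (\<Union>S\<in>rooks b n r. permutations_of_set S)"
    unfolding assms
    by (auto simp: words_def rooks_def permutations_of_set_def distinct_map distinct_card)
  also have "card \<dots> = (\<Sum>S\<in>rooks b n r. card (permutations_of_set S))"
    by (rule card_UN_disjoint) (auto simp: finite_rooks dest: permutations_of_setD)
  also have "\<dots> = (\<Sum>S\<in>rooks b n r. fact r)"
  proof (rule sum.cong[OF refl])
    fix S assume S: "S \<in> rooks b n r"
    then have "card S = r" by (simp add: rooks_def)
    then show "card (permutations_of_set S) = fact r" using rooks_finite_member[OF S] by simp
  qed
  finally show ?thesis by simp
qed

text \<open>The factor \<open>exp L\<close> cancels \<open>exp (- L)\<close>, which turns an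
  absolute error for \<open>s / B\<close> into the form of the theorem.\<close>

lemma relative_error_bounds:
  fixes B L s err :: real
  assumes "B > 0" "exp (- L) - s / B \<le> err" "- (exp (- L) - s / B) \<le> err"
  shows "B * exp (- L) * (1 - exp L * err) \<le> s" "s \<le> B * exp (- L) * (1 + exp L * err)"
proof -
  have e: "exp (- L) * exp L = 1" by (simp add: exp_minus)
  have "B * exp (- L) * (1 - exp L * err) = B * (exp (- L) - (exp (- L) * exp L) * err)"
    by (simp add: algebra_simps)
  then show "B * exp (- L) * (1 - exp L * err) \<le> s"
    using assms e by (simp add: field_simps)
  have "B * exp (- L) * (1 + exp L * err) = B * (exp (- L) + (exp (- L) * exp L) * err)"
    by (simp add: algebra_simps)
  then show "s \<le> B * exp (- L) * (1 + exp L * err)"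
    using assms e by (simp add: field_simps)
qed

section \<open>Error bounds\<close>

text \<open>Here \<open>d\<close> is the number of features. All joint collision probabilities are
  at most \<open>1 / (n choose 2)\<close>, which serves as \<open>q\<close>.\<close>

lemma staircase_poisson:
  fixes n r :: nat and b :: bool
  assumes n: "n \<ge> 2"
  defines "d \<equiv> if b then 2 else 1 :: nat"
  defines "p \<equiv> 4/3 * (real n - 1/2) / (real n * (real n - 1))"
  defines "m \<equiv> (r choose 2) * d" and "M \<equiv> (2 * r - 3) * d"
  defines "D \<equiv> exp (- (real m * p)) - real (card (rooks b n r)) / (real (n choose 2) ^ r / fact r)"
  shows "D \<le> real m * real M * p\<^sup>2" and "- D \<le> real m * real (M - 1) / real (n choose 2)"
proof -
  define \<Phi> :: "(nat \<times> nat \<Rightarrow> nat) set" where "\<Phi> = (if b then {fst, snd} else {snd})"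
  have neq: "(fst :: nat \<times> nat \<Rightarrow> nat) \<noteq> snd"
    by (metis fst_conv snd_conv zero_neq_one)
  have card: "card \<Phi> = d" "finite \<Phi>" using neq by (auto simp: \<Phi>_def d_def)
  have mem: "\<phi> \<in> {fst, snd}" if "\<phi> \<in> \<Phi>" for \<phi> using that by (auto simp: \<Phi>_def split: if_splits)
  have "(0, 1) \<in> stair n" using n by (simp add: stair_def)
  then have ne: "stair n \<noteq> {}" by blast
  have D: "D = exp (- (real m * p))
    - real (card {xs\<in>words (stair n) r. \<forall>\<phi>\<in>\<Phi>. distinct (map \<phi> xs)}) / real (card (stair n)) ^ r"
    unfolding D_def card_distinct_words[OF \<Phi>_def] card_stair by (simp add: field_simps)
  have eq: "mean (stair n) (\<lambda>e. mean (stair n) (\<lambda>e'. of_bool (\<phi> e = \<phi> e' \<and> \<psi> e = \<psi> e')))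
      \<le> 1 / real (n choose 2)" if "\<phi> \<in> \<Phi>" "\<psi> \<in> \<Phi>" "\<phi> \<noteq> \<psi>" for \<phi> \<psi>
  proof -
    have "(\<phi> e = \<phi> e' \<and> \<psi> e = \<psi> e') \<longleftrightarrow> e = e'" for e e'
      using mem[OF that(1)] mem[OF that(2)] that(3) by (auto simp: prod_eq_iff)
    then show ?thesis using mean_eq_stair by simp
  qed
  have p: "mean (stair n) (coll (stair n) \<phi>) = p" if "\<phi> \<in> \<Phi>" for \<phi>
    unfolding p_def using mean_coll_stair[OF mem[OF that] n] .
  have q: "mean (stair n) (\<lambda>e. (coll (stair n) \<phi> e)\<^sup>2) \<le> 1 / real (n choose 2)" if "\<phi> \<in> \<Phi>" for \<phi>
    using mean_coll_stair_sq[OF mem[OF that] n] by simp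
  show "D \<le> real m * real M * p\<^sup>2"
    unfolding D m_def M_def card(1)[symmetric]
    by (rule distinct_words_poisson(1)[OF finite_stair ne card(2) p q eq])
  have "- D \<le> real m * real (M - 1) * (1 / real (n choose 2))"
    unfolding D m_def M_def card(1)[symmetric]
    by (rule distinct_words_poisson(2)[OF finite_stair ne card(2) p q eq])
  then show "- D \<le> real m * real (M - 1) / real (n choose 2)" by simp
qed

text \<open>The left side is the joint-probability bound for two features: m = r(r - 1) and M - 1 =
  2(2r - 3) - 1 = 4r - 7. With 4r - 7 = 1 + 4(r - 2) and r - 3/2 = 1/2 + (r - 2), it suffices to
  compare the constant terms and the coefficients of r - 2.\<close>

lemma second_kind_error_bound:
  fixes n r :: real
  assumes n: "n \<ge> 2" and r: "r \<ge> 2"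
  shows "r * (r - 1) * (4 * r - 7) / (n * (n - 1) / 2)
    \<le> r * (r - 1) * (r - 3/2) * (64 / (9 * n\<^sup>2)) * ((n - 1/2)\<^sup>2 / (n - 1)\<^sup>2)
      + r * (r - 1) * (r - 2) * (40 / (3 * n\<^sup>2)) * ((n * (n - 17/5) + 17/5) / (n - 1)\<^sup>2)"
proof -
  define K where "K = n\<^sup>2 * (n - 1)\<^sup>2"
  have K: "K > 0" using n by (simp add: K_def)
  have A: "2 * (n * (n - 1)) \<le> 32/9 * (n - 1/2)\<^sup>2"
    using n mult_mono[of 2 n 1 "n - 1"] by (simp add: power2_eq_square algebra_simps)
  have C: "8 * (n * (n - 1)) \<le> 64/9 * (n - 1/2)\<^sup>2 + 40/3 * (n * (n - 17/5) + 17/5)"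
    \<comment> \<open>The difference of the two sides is (112 n^2 - 400 n + 424) / 9, a positive
      quadratic with its vertex at 25/14.\<close>
    using zero_le_square[of "n - 25/14"] by (simp add: power2_eq_square field_simps)
  have "(4 * r - 7) * 2 * (n * (n - 1)) = 2 * (n * (n - 1)) + (r - 2) * (8 * (n * (n - 1)))"
    by (simp add: algebra_simps)
  also have "\<dots> \<le> 32/9 * (n - 1/2)\<^sup>2
      + (r - 2) * (64/9 * (n - 1/2)\<^sup>2 + 40/3 * (n * (n - 17/5) + 17/5))"
    using A C r by (intro add_mono mult_left_mono) auto
  also have "\<dots> = (r - 3/2) * (64/9) * (n - 1/2)\<^sup>2 + (r - 2) * (40/3) * (n * (n - 17/5) + 17/5)"
    by (simp add: field_simps)
  finally have "r * (r - 1) * ((4 * r - 7) * 2 * (n * (n - 1))) / K \<le> r * (r - 1) *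
      ((r - 3/2) * (64/9) * (n - 1/2)\<^sup>2 + (r - 2) * (40/3) * (n * (n - 17/5) + 17/5)) / K"
    using r K by (intro divide_right_mono mult_left_mono) auto
  moreover have "r * (r - 1) * (4 * r - 7) / (n * (n - 1) / 2)
      = r * (r - 1) * ((4 * r - 7) * 2 * (n * (n - 1))) / K"
  proof -
    have "K = (n * (n - 1)) * (n * (n - 1))" by (simp add: K_def power2_eq_square)
    moreover have "n * (n - 1) \<noteq> 0" using n by simp
    ultimately show ?thesis by simp
  qed
  moreover have "P * (X * (64/9) * u + Y * (40/3) * v) / (a * b)
      = P * X * (64 / (9 * a)) * (u / b) + P * Y * (40 / (3 * a)) * (v / b)" for P X Y a b u v :: real
    by (simp add: add_divide_distrib distrib_left mult_ac)
  ultimately show ?thesis unfolding K_def by (simp only:)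
qed

theorem theorem5p2:
  fixes n k :: nat and r :: nat and lam f1 f2 c1 c2 B :: real
  assumes "n \<ge> 2" and "1 \<le> k" and "k \<le> n"
    and "r = n - k"
    and "lam = 4/3 * real (r choose 2) * (real n - 1/2) / (real n * (real n - 1))"
    and "f1 = real (r choose 2) * (2 * real r - 3)
              * (4 / (3 * real n) * ((real n - 1/2) / (real n - 1)))^2"
    and "f2 = real (r choose 2) * (2 * real r - 3) / real (n choose 2)"
    and "c1 = real r * (real r - 1) * (real r - 3/2) * (64 / (9 * (real n)^2))
              * ((real n - 1/2)^2 / (real n - 1)^2)"
    and "c2 = real r * (real r - 1) * (real r - 2) * (40 / (3 * (real n)^2))
              * ((real n * (real n - 17/5) + 17/5) / (real n - 1)^2)"
    and "B = real (n choose 2) ^ r / fact r"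
  shows "B * exp (- lam) * (1 - exp lam * (f1 + f2)) \<le> real (stirling n k)
       \<and> real (stirling n k) \<le> B * exp (- lam) * (1 + exp lam * (f1 + f2))
       \<and> B * exp (- 2 * lam) * (1 - exp (2 * lam) * (c1 + c2)) \<le> real (Stirling n k)
       \<and> real (Stirling n k) \<le> B * exp (- 2 * lam) * (1 + exp (2 * lam) * (c1 + c2))"
proof -
  define p where "p = 4/3 * (real n - 1/2) / (real n * (real n - 1))"
  have n: "real n \<ge> 2" using assms(1) by simp
  have N: "real (n choose 2) > 0" using n by (simp add: real_choose_two)
  have B: "B > 0" using N assms(10) by simp
  have nr: "r \<le> n" "n - r = k" using assms(3,4) by auto
  have psq: "p\<^sup>2 = (4 / (3 * real n) * ((real n - 1/2) / (real n - 1)))\<^sup>2"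
    by (simp add: p_def mult.assoc)
  \<comment> \<open>For \<open>r \<le> 1\<close> the natural number \<open>2 * r - 3\<close> is
    truncated while the real one is negative, but the binomial factor is 0.\<close>
  have r_cases: "r choose 2 = 0 \<or> r \<ge> 2" by (cases "r \<ge> 2") (auto simp: binomial_eq_0)
  have f1: "real (r choose 2) * real (2 * r - 3) * p\<^sup>2 = f1"
    unfolding assms(6) psq using r_cases by (auto simp: of_nat_diff)
  have f2: "real (r choose 2) * real (2 * r - 3 - 1) / real (n choose 2) \<le> f2"
  proof (cases "r \<ge> 2")
    case True
    then have "real (2 * r - 3 - 1) \<le> 2 * real r - 3" by (simp add: of_nat_diff)
    then show ?thesis unfolding assms(7) by (intro divide_right_mono mult_left_mono) auto
  next
    case False
    then show ?thesis unfolding assms(7) by (simp add: binomial_eq_0)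
  qed
  have f1_nonneg: "0 \<le> f1" unfolding f1[symmetric] by simp
  have f2_nonneg: "0 \<le> f2" by (rule order_trans[OF _ f2]) simp
  have lam: "real (r choose 2) * p = lam" unfolding assms(5) p_def by simp
  have first: "exp (- lam) - real (stirling n k) / B \<le> f1" "- (exp (- lam) - real (stirling n k) / B) \<le> f2"
    using staircase_poisson[OF assms(1), of r False, folded p_def] f1 f2 nr
    by (simp_all add: card_rooks lam assms(10))
  have rr: "real (r choose 2) * 2 = real r * (real r - 1)" by (simp add: real_choose_two)
  \<comment> \<open>Here M = 2(2r - 3) = 4(r - 3/2), and the 4 joins the 16/9 of
    \<open>p\<^sup>2\<close> to give 64/9.\<close>
  have c1: "real ((r choose 2) * 2) * real ((2 * r - 3) * 2) * p\<^sup>2 = c1"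
  proof (cases "r \<ge> 2")
    case True
    then have "real (2 * r - 3) = 2 * real r - 3" by (simp add: of_nat_diff)
    moreover have "p\<^sup>2 = 16 / (9 * (real n)\<^sup>2) * ((real n - 1/2)\<^sup>2 / (real n - 1)\<^sup>2)"
      unfolding psq power_mult_distrib power_divide by simp
    moreover have "x * ((2 * y - 3) * 2) * (t * w) = x * (y - 3/2) * (4 * t) * w" for x y t w :: real
      by (simp add: algebra_simps)
    moreover have "64 / (9 * (real n)\<^sup>2) = 4 * (16 / (9 * (real n)\<^sup>2))" by simp
    ultimately show ?thesis unfolding assms(8) of_nat_mult of_nat_numeral rr by (simp only:)
  next
    case False
    then have "r = 0 \<or> r = 1" by auto
    then show ?thesis unfolding assms(8) by auto
  qed
  have c2_nonneg: "0 \<le> c2"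
  proof (cases "r \<ge> 2")
    case True
    \<comment> \<open>Completing the square leaves 17/5 - (17/10)^2 = 51/100 > 0.\<close>
    have "0 \<le> (real n - 17/10)\<^sup>2" by simp
    then have "0 \<le> real n * (real n - 17/5) + 17/5" by (simp add: power2_eq_square algebra_simps)
    then show ?thesis unfolding assms(9) using True by simp
  next
    case False
    then have "r = 0 \<or> r = 1" by auto
    then show ?thesis unfolding assms(9) by auto
  qed
  have c1_nonneg: "0 \<le> c1" unfolding c1[symmetric] by simp
  have c12: "real ((r choose 2) * 2) * real ((2 * r - 3) * 2 - 1) / real (n choose 2) \<le> c1 + c2"
  proof (cases "r \<ge> 2")
    case True
    then have "real ((2 * r - 3) * 2 - 1) = 4 * real r - 7" by (simp add: of_nat_diff)
    then show ?thesis unfolding assms(8,9) of_nat_mult of_nat_numeral rr real_choose_two[of n]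
      using second_kind_error_bound[of "real n" "real r"] True n by simp
  next
    case False
    then show ?thesis using c1_nonneg c2_nonneg by (simp add: binomial_eq_0)
  qed
  have lam2: "real (r choose 2) * 2 * p = 2 * lam" using lam by simp
  have second: "exp (- (2 * lam)) - real (Stirling n k) / B \<le> c1 + c2"
    "- (exp (- (2 * lam)) - real (Stirling n k) / B) \<le> c1 + c2"
    using staircase_poisson[OF assms(1), of r True, folded p_def] c1 c2_nonneg c12 nr
    by (simp_all add: card_rooks lam2 assms(10))
  \<comment> \<open>Each one-sided estimate is weakened to the common error \<open>f1 + f2\<close>
    or \<open>c1 + c2\<close>, using nonnegativity of the summands.\<close>
  show ?thesis
    using relative_error_bounds[OF B, of lam "real (stirling n k)" "f1 + f2"]
      relative_error_bounds[OF B, of "2 * lam" "real (Stirling n k)" "c1 + c2"]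
      first second f1_nonneg f2_nonneg by simp
qed

end
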